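(* Let $k$ be a positive integer. Let $G=(V,E,\partial)$ be a finite undirected graph with $V$ the disjoint union of $\{v_1,v_2,v_3,v_4\}$ (four distinct vertices) and a (possibly empty) set $Y$. Let $y_1,\ldots,y_m$ be all the vertices of $Y$ having odd degree in $G$ ($m=0$ if there are none). Suppose that after the deletion of any $k-1$ or fewer edges from $G$ there still exists a chain of edges $p$ with $\partial(p)=v_1+v_2+v_3+v_4$. Let $GN$ be any graph obtained from $G$ by adding new edges $\epsilon_1,\ldots,\epsilon_n$ such that each $\partial(\epsilon_i)$ is a sum of two different vertices, one from $\{y_1,\ldots,y_m\}$ and the other from $\{v_1,v_2,v_3,v_4,y_1,\ldots,y_m\}$, and such that each of $y_1,\ldots,y_m$ lies in the boundary of exactly one of the new edges ($n=0$ and $GN=G$ if $m=0$). Then in $GN$ there exist $k$ chains of edges $p_1,\ldots,p_k$, no two of which have a common nontrivial summand, such that $\partial(p_1)=\cdots=\partial(p_k)=v_1+v_2+v_3+v_4$ in $GN$.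
   Context: A graph $G=(V,E,\partial)$ consists of a finite nonempty vertex set $V$, a finite edge set $E$, and a map $\partial$ assigning to each edge a set of exactly two distinct vertices (parallel edges allowed, no loops); we write $\partial(e)=a+b$ for $\partial(e)=\{a,b\}$. The degree of a vertex $v$ is the number of edges $e$ with $v\in\partial(e)$. $A(S)$ is the $\mathbb{F}_2$-vector space of formal $\mathbb{F}_2$-linear combinations of elements of $S$; elements of $A(E)$ are chains of edges, with summands the edges of coefficient $1$. Two chains have no common nontrivial summand if no edge is a summand of both. $\partial$ extends $\mathbb{F}_2$-linearly to $A(E)\to A(V)$. Deleting edges means removing them from $E$ (the vertex set is unchanged). *)

theory Defs
  imports Main "HOL-Library.Z2" "HOL-Library.Poly_Mapping"
begin

record ('v, 'e) graph =
  verts :: "'v set"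
  edges :: "'e set"
  bd :: "'e \<Rightarrow> 'v set"

text \<open>The field \<open>bd\<close> is a total function; its values outside \<open>edges G\<close> are irrelevant.\<close>

definition is_graph :: "('v, 'e) graph \<Rightarrow> bool" where
  "is_graph G \<longleftrightarrow>
     finite (verts G) \<and> verts G \<noteq> {} \<and> finite (edges G) \<and>
     (\<forall>e \<in> edges G. bd G e \<subseteq> verts G \<and> card (bd G e) = 2)"

definition degree :: "('v, 'e) graph \<Rightarrow> 'v \<Rightarrow> nat" where
  "degree G v = card {e \<in> edges G. v \<in> bd G e}"

definition delete_edges :: "('v, 'e) graph \<Rightarrow> 'e set \<Rightarrow> ('v, 'e) graph" where
  "delete_edges G D = G\<lparr>edges := edges G - D\<rparr>"

definition adds_edges :: "('v, 'e) graph \<Rightarrow> 'e set \<Rightarrow> ('v, 'e) graph \<Rightarrow> bool" where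
  "adds_edges G N GN \<longleftrightarrow>
     is_graph GN \<and> verts GN = verts G \<and>
     N \<inter> edges G = {} \<and> edges GN = edges G \<union> N \<and>
     (\<forall>e \<in> edges G. bd GN e = bd G e)"

text \<open>
  Formal linear combinations over the two-element field \<open>bit\<close> are finitely supported
  functions into \<open>bit\<close>; \<open>A(S)\<close> consists of those supported in \<open>S\<close>, and the summands of a
  combination are its keys.
\<close>

definition chains_on :: "'a set \<Rightarrow> ('a \<Rightarrow>\<^sub>0 bit) set" where
  "chains_on S = {p. Poly_Mapping.keys p \<subseteq> S}"

definition gen :: "'a \<Rightarrow> 'a \<Rightarrow>\<^sub>0 bit" where
  "gen a = Poly_Mapping.single a 1"

definition no_common_summand :: "('a \<Rightarrow>\<^sub>0 bit) \<Rightarrow> ('a \<Rightarrow>\<^sub>0 bit) \<Rightarrow> bool" where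
  "no_common_summand p q \<longleftrightarrow> Poly_Mapping.keys p \<inter> Poly_Mapping.keys q = {}"

text \<open>
  The linear extension of \<open>bd\<close>: every nonzero coefficient is \<open>1\<close>, so no scalars appear in the
  sum. The lemmas below confirm that this is the additive map with the prescribed values on
  edges.
\<close>

definition boundary :: "('v, 'e) graph \<Rightarrow> ('e \<Rightarrow>\<^sub>0 bit) \<Rightarrow> ('v \<Rightarrow>\<^sub>0 bit)" where
  "boundary G p = (\<Sum>e \<in> Poly_Mapping.keys p. \<Sum>v \<in> bd G e. gen v)"

lemma bit_chain_double: "p + p = (0 :: 'a \<Rightarrow>\<^sub>0 bit)"
  by (rule poly_mapping_eqI) (simp add: lookup_add)

lemma boundary_superset:
  assumes "finite S" "Poly_Mapping.keys p \<subseteq> S"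
  shows "boundary G p =
    (\<Sum>e \<in> S. if Poly_Mapping.lookup p e = 1 then \<Sum>v \<in> bd G e. gen v else 0)"
  unfolding boundary_def
  by (rule sum.mono_neutral_cong_left) (use assms in \<open>auto simp: in_keys_iff\<close>)

lemma boundary_add: "boundary G (p + q) = boundary G p + boundary G q"
proof -
  let ?S = "Poly_Mapping.keys p \<union> Poly_Mapping.keys q"
  have sub: "Poly_Mapping.keys (p + q) \<subseteq> ?S"
    by (rule Poly_Mapping.keys_add)
  show ?thesis
    by (subst (1 2 3) boundary_superset[where S = ?S])
       (use sub in \<open>auto simp: lookup_add bit_chain_double sum.distrib[symmetric]
          intro!: sum.cong\<close>)
qed

lemma boundary_gen: "boundary G (gen e) = (\<Sum>v \<in> bd G e. gen v)"
  by (simp add: boundary_def gen_def)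

lemma boundary_edge:
  assumes "bd G e = {a, b}" "a \<noteq> b"
  shows "boundary G (gen e) = gen a + gen b"
  using assms by (simp add: boundary_gen)

end

(*
  By parity the hypothesis says that every vertex set X containing an odd number of the v_i is
  left by at least k edges, and in GN all vertices of Y have even degree. At a vertex y of Y
  that still has an edge, Lovasz's uncrossing argument finds a pair of edges uy, wy that can be
  replaced by one edge uw (or by nothing if u = w) without destroying the cut condition; joins
  of the smaller graph lift back, with uw replaced by the pair. Iterating leaves a multigraph
  on the four vertices v_i with all degrees at least k. There, either two disjoint edges exist
  and are removed as one join, or all edges share a vertex, whose degree is then at least 3k,
  and a star of three edges is removed.
*)
theory Submission
  imports Defs "HOL-Library.Disjoint_Sets"
begin

section \<open>Cuts, \<open>T\<close>-joins and packings of joins\<close>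

text \<open>For a singleton \<open>X = {v}\<close> this is the degree of \<open>v\<close>.\<close>

definition cut_size :: "('e \<Rightarrow> 'v set) \<Rightarrow> 'e set \<Rightarrow> 'v set \<Rightarrow> nat" where
  "cut_size B E X = card {e \<in> E. odd (card (B e \<inter> X))}"

text \<open>No vertex set is recorded: a vertex without edges just has degree zero, so splitting off
  never has to delete a vertex.\<close>

definition multigraph :: "('e \<Rightarrow> 'v set) \<Rightarrow> 'e set \<Rightarrow> bool" where
  "multigraph B E \<longleftrightarrow> finite E \<and> (\<forall>e \<in> E. card (B e) = 2)"

text \<open>The \<open>T\<close>-joins of combinatorial optimization: edge sets whose boundary
  modulo 2 is \<open>T\<close>.\<close>

definition is_join :: "('e \<Rightarrow> 'v set) \<Rightarrow> 'v set \<Rightarrow> 'e set \<Rightarrow> bool" where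
  "is_join B T P \<longleftrightarrow> (\<forall>v. odd (cut_size B P {v}) \<longleftrightarrow> v \<in> T)"

definition join_packing :: "('e \<Rightarrow> 'v set) \<Rightarrow> 'e set \<Rightarrow> 'v set \<Rightarrow> nat \<Rightarrow> (nat \<Rightarrow> 'e set) \<Rightarrow> bool" where
  "join_packing B E T k P \<longleftrightarrow>
     (\<forall>i \<in> {1..k}. P i \<subseteq> E \<and> is_join B T (P i)) \<and> disjoint_family_on P {1..k}"

section \<open>Cut sizes under changes of the edge set\<close>

lemma odd_card_Int_singleton [simp]: "odd (card (A \<inter> {v})) \<longleftrightarrow> v \<in> A"
  by (cases "v \<in> A") auto

lemma odd_card_pair_Int [simp]:
  "a \<noteq> b \<Longrightarrow> odd (card ({a, b} \<inter> X)) \<longleftrightarrow> (a \<in> X) \<noteq> (b \<in> X)"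
  by (auto simp: Int_insert_left)

lemma cut_size_singleton: "cut_size B E {v} = card {e \<in> E. v \<in> B e}"
  by (simp add: cut_size_def)

lemma cut_size_empty [simp]: "cut_size B {} X = 0"
  by (simp add: cut_size_def)

lemma cut_size_insert:
  assumes "finite E" "e \<notin> E"
  shows "cut_size B (insert e E) X = of_bool (odd (card (B e \<inter> X))) + cut_size B E X"
proof -
  have "{e' \<in> insert e E. odd (card (B e' \<inter> X))} =
    (if odd (card (B e \<inter> X)) then insert e {e' \<in> E. odd (card (B e' \<inter> X))}
     else {e' \<in> E. odd (card (B e' \<inter> X))})"
    by auto
  then show ?thesis using assms by (auto simp: cut_size_def)
qed

lemma cut_size_remove:
  assumes "finite E" "e \<in> E"
  shows "cut_size B E X = of_bool (odd (card (B e \<inter> X))) + cut_size B (E - {e}) X"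
  using cut_size_insert[of "E - {e}" e B X] assms by (simp add: insert_absorb)

lemma cut_size_Diff:
  assumes "finite E" "J \<subseteq> E"
  shows "cut_size B E X = cut_size B (E - J) X + cut_size B J X"
  unfolding cut_size_def
  by (subst card_Un_disjoint[symmetric])
     (use assms in \<open>auto intro: finite_subset intro!: arg_cong[where f = card]\<close>)

lemma cut_size_mono:
  assumes "finite E" "J \<subseteq> E"
  shows "cut_size B J X \<le> cut_size B E X"
  using cut_size_Diff[OF assms, of B X] by simp

lemma cut_size_cong:
  assumes "\<And>e. e \<in> E \<Longrightarrow> B e = B' e"
  shows "cut_size B E X = cut_size B' E X"
  unfolding cut_size_def using assms by (auto intro: arg_cong[where f = card])

lemma multigraph_edgeE:
  assumes "multigraph B E" "e \<in> E"
  obtains a b where "B e = {a, b}" "a \<noteq> b"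
  using assms by (auto simp: multigraph_def card_2_iff)

lemma multigraph_edge_atE:
  assumes "multigraph B E" "e \<in> E" "y \<in> B e"
  obtains u where "B e = {u, y}" "u \<noteq> y"
proof -
  obtain a b where "B e = {a, b}" "a \<noteq> b" using multigraph_edgeE[OF assms(1,2)] .
  then show thesis using that[of a] that[of b] assms(3) by (auto simp: insert_commute)
qed

lemma multigraph_subset: "multigraph B E \<Longrightarrow> J \<subseteq> E \<Longrightarrow> multigraph B J"
  by (auto simp: multigraph_def intro: finite_subset)

lemma cut_size_Compl:
  assumes "multigraph B E"
  shows "cut_size B E (- X) = cut_size B E X"
proof -
  have "odd (card (B e \<inter> - X)) \<longleftrightarrow> odd (card (B e \<inter> X))" if "e \<in> E" for e
    using multigraph_edgeE[OF assms that] by (metis Compl_iff odd_card_pair_Int)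
  then show ?thesis by (auto simp: cut_size_def intro: arg_cong[where f = card])
qed

section \<open>Parity of cuts\<close>

text \<open>Handshake argument: summing the degrees over \<open>X\<close> counts an edge inside
  \<open>X\<close> twice and an edge of the cut once.\<close>

lemma odd_cut_size_iff:
  assumes "multigraph B E"
  shows "odd (cut_size B E X) \<longleftrightarrow> odd (card {v \<in> X. odd (cut_size B E {v})})"
proof -
  \<comment> \<open>\<open>X\<close> may be infinite; only the finitely many vertices on edges
    contribute.\<close>
  define W where "W = X \<inter> (\<Union>e \<in> E. B e)"
  have finB: "finite (B e)" if "e \<in> E" for e
    using multigraph_edgeE[OF assms that] by (metis finite.emptyI finite_insert)
  have fin: "finite E" "finite W"
    using assms finB by (auto simp: multigraph_def W_def)
  have "(\<Sum>v \<in> W. cut_size B E {v}) = (\<Sum>v \<in> W. \<Sum>e \<in> E. of_bool (v \<in> B e))"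
    using fin by (simp add: cut_size_singleton Int_def)
  also have "\<dots> = (\<Sum>e \<in> E. \<Sum>v \<in> W. of_bool (v \<in> B e))"
    by (rule sum.swap)
  also have "\<dots> = (\<Sum>e \<in> E. card (B e \<inter> X))"
  proof (rule sum.cong)
    fix e assume "e \<in> E"
    then have "{v \<in> W. v \<in> B e} = B e \<inter> X" by (auto simp: W_def)
    then show "(\<Sum>v \<in> W. of_bool (v \<in> B e)) = card (B e \<inter> X)"
      using fin by (simp add: Int_def)
  qed simp
  finally have "odd (cut_size B E X) \<longleftrightarrow> odd (\<Sum>v \<in> W. cut_size B E {v})"
    using fin by (simp add: cut_size_def even_sum_iff)
  also have "\<dots> \<longleftrightarrow> odd (card {v \<in> W. odd (cut_size B E {v})})"
    using fin by (simp add: even_sum_iff)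
  also have "{v \<in> W. odd (cut_size B E {v})} = {v \<in> X. odd (cut_size B E {v})}"
  proof -
    have "v \<in> (\<Union>e \<in> E. B e)" if "odd (cut_size B E {v})" for v
    proof (rule ccontr)
      assume "v \<notin> (\<Union>e \<in> E. B e)"
      then have "{e \<in> E. v \<in> B e} = {}" by auto
      with that show False by (simp add: cut_size_singleton)
    qed
    then show ?thesis by (auto simp: W_def)
  qed
  finally show ?thesis .
qed

text \<open>In particular a join crosses every cut with odd trace on \<open>T\<close>, which is how
  the existence of chains becomes a bound on cuts.\<close>

lemma odd_cut_size_join:
  assumes "multigraph B P" "is_join B T P"
  shows "odd (cut_size B P X) \<longleftrightarrow> odd (card (X \<inter> T))"
  using odd_cut_size_iff[OF assms(1), of X] assms(2)
  by (simp add: is_join_def Int_def)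

section \<open>Submodularity and posimodularity of cuts\<close>

lemma cut_size_eq_sum: "finite E \<Longrightarrow> cut_size B E X = (\<Sum>e \<in> E. of_bool (odd (card (B e \<inter> X))))"
  by (simp add: cut_size_def Int_def)

text \<open>The inequality already holds for each single edge, by cases on the position of its two
  ends.\<close>

lemma cut_size_submodular:
  assumes "multigraph B E"
  shows "cut_size B E (X \<inter> Z) + cut_size B E (X \<union> Z) \<le> cut_size B E X + cut_size B E Z"
proof -
  have "of_bool (odd (card (B e \<inter> (X \<inter> Z)))) + of_bool (odd (card (B e \<inter> (X \<union> Z)))) \<le>
      (of_bool (odd (card (B e \<inter> X))) + of_bool (odd (card (B e \<inter> Z))) :: nat)" if "e \<in> E" for e
  proof -
    obtain a b where "B e = {a, b}" "a \<noteq> b" using multigraph_edgeE[OF assms \<open>e \<in> E\<close>] .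
    then show ?thesis
      by (cases "a \<in> X"; cases "b \<in> X"; cases "a \<in> Z"; cases "b \<in> Z")
        (simp_all del: Int_iff Un_iff add: Int_iff[of _ X Z] Un_iff[of _ X Z])
  qed
  moreover have "finite E" using assms by (simp add: multigraph_def)
  ultimately show ?thesis
    by (simp only: cut_size_eq_sum sum.distrib[symmetric] sum_mono)
qed

text \<open>The edge \<open>e\<close> is cut by both \<open>X\<close> and \<open>Z\<close>, but by
  neither their intersection nor their union; plain submodularity serves the other edges.\<close>

lemma cut_size_submodular_strict:
  assumes "multigraph B E" "e \<in> E" "B e = {a, b}" "a \<in> X - Z" "b \<in> Z - X"
  shows "cut_size B E (X \<inter> Z) + cut_size B E (X \<union> Z) + 2 \<le> cut_size B E X + cut_size B E Z"
proof -
  have fin: "finite E" using assms(1) by (simp add: multigraph_def)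
  have "a \<noteq> b" using assms by auto
  then show ?thesis
    using cut_size_submodular[OF multigraph_subset[OF assms(1), of "E - {e}"], of X Z] assms(4,5)
    by (simp add: cut_size_remove[OF fin assms(2)] assms(3))
qed

text \<open>This is submodularity for \<open>X\<close> and the complement of \<open>Z\<close>, since
  a set and its complement have the same cut.\<close>

lemma cut_size_posimodular:
  assumes "multigraph B E"
  shows "cut_size B E (X - Z) + cut_size B E (Z - X) \<le> cut_size B E X + cut_size B E Z"
proof -
  have "- (X \<union> - Z) = Z - X" by auto
  then show ?thesis
    using cut_size_submodular[OF assms, of X "- Z"] cut_size_Compl[OF assms, of "X \<union> - Z"]
      cut_size_Compl[OF assms, of Z]
    by (simp add: Diff_eq)
qed

lemma cut_size_posimodular_strict:
  assumes "multigraph B E" "e \<in> E" "B e = {a, b}" "a \<in> X \<inter> Z" "b \<notin> X \<union> Z"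
  shows "cut_size B E (X - Z) + cut_size B E (Z - X) + 2 \<le> cut_size B E X + cut_size B E Z"
proof -
  have "- (X \<union> - Z) = Z - X" by auto
  then show ?thesis
    using cut_size_submodular_strict[OF assms(1-3), of X "- Z"] assms(4,5)
      cut_size_Compl[OF assms(1), of "X \<union> - Z"] cut_size_Compl[OF assms(1), of Z]
    by (simp add: Diff_eq)
qed

text \<open>All edges at \<open>y\<close> lead into \<open>X\<close>, so exactly these leave the cut
  when \<open>y\<close> moves into \<open>X\<close>.\<close>

lemma cut_size_insert_vertex:
  assumes "multigraph B E" "y \<notin> X" "\<And>e. e \<in> E \<Longrightarrow> y \<in> B e \<Longrightarrow> B e \<subseteq> insert y X"
  shows "cut_size B E (insert y X) + cut_size B E {y} = cut_size B E X"
proof -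
  have "of_bool (odd (card (B e \<inter> insert y X))) + of_bool (odd (card (B e \<inter> {y}))) =
      (of_bool (odd (card (B e \<inter> X))) :: nat)" if e: "e \<in> E" for e
  proof (cases "y \<in> B e")
    case True
    then obtain u where "B e = {u, y}" "u \<noteq> y" using multigraph_edge_atE[OF assms(1) e] by blast
    then show ?thesis using assms(2) assms(3)[OF e True] by auto
  next
    case False
    then show ?thesis by simp
  qed
  moreover have "finite E" using assms(1) by (simp add: multigraph_def)
  ultimately show ?thesis
    by (simp only: cut_size_eq_sum sum.distrib[symmetric] cong: sum.cong)
qed

section \<open>Splitting off a pair of edges at an inner vertex\<close>

text \<open>
  Since inner degrees are even, the parity of a cut depends only on its trace on \<open>T\<close>; hence every
  cut with trace \<open>{t}\<close> of size at most \<open>k + 1\<close> is a minimum one among those with trace \<open>{t}\<close>.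
  If no partner of \<open>e\<close> worked, uncrossing these tight cuts would yield a single one that has
  \<open>y\<close> on one side and all its neighbours on the other, and moving \<open>y\<close> across would give a
  smaller cut.
\<close>

lemma exists_splittable_edge:
  assumes mg: "multigraph B E"
    and inner: "\<And>v. v \<notin> T \<Longrightarrow> even (cut_size B E {v})"
    and cuts: "\<And>X. odd (card (X \<inter> T)) \<Longrightarrow> k \<le> cut_size B E X"
    and T: "card T = 4" and y: "y \<notin> T"
    and e: "e \<in> E" "B e = {u, y}" "u \<noteq> y"
  obtains f w where "f \<in> E" "f \<noteq> e" "B f = {w, y}" "w \<noteq> y"
    "\<And>X. odd (card (X \<inter> T)) \<Longrightarrow> (u \<in> X) = (w \<in> X) \<Longrightarrow> (y \<in> X) \<noteq> (u \<in> X) \<Longrightarrow>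
       k + 2 \<le> cut_size B E X"
proof (rule ccontr)
  assume "\<not> thesis"
  note none = that[THEN notE[OF this]]
  let ?d = "cut_size B E"
  \<comment> \<open>Splitting costs a cut two edges if \<open>y\<close> lies opposite both
    \<open>u\<close> and \<open>w\<close>, so an obstructing cut has size below
    \<open>k + 2\<close>. Passing to complements allows its trace to be a singleton.\<close>
  define tight where "tight X \<longleftrightarrow> is_singleton (X \<inter> T) \<and> ?d X < k + 2" for X
  have finE: "finite E" using mg by (simp add: multigraph_def)
  have parity: "even (?d X) = even (?d X')" if "X \<inter> T = X' \<inter> T" for X X'
  proof -
    have "{v \<in> X. odd (?d {v})} = {v \<in> X'. odd (?d {v})}" using that inner by blast
    then show ?thesis using odd_cut_size_iff[OF mg, of X] odd_cut_size_iff[OF mg, of X'] by simp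
  qed
  have tight_le: "?d X \<le> ?d X'" if "tight X" "X' \<inter> T = X \<inter> T" for X X'
  proof -
    have "odd (card (X' \<inter> T))" using that by (auto simp: tight_def is_singleton_altdef)
    then have "k \<le> ?d X'" by (rule cuts)
    moreover have "?d X < k + 2" using that(1) by (simp add: tight_def)
    moreover have "?d X = Suc k \<and> ?d X' = k" if "\<not> ?d X \<le> ?d X'"
      using that calculation by linarith
    ultimately show ?thesis using parity[OF that(2)] by (metis even_Suc)
  qed
  have tight_eq: "X \<inter> T = X' \<inter> T \<or> X \<inter> X' \<inter> T = {}" if tight: "tight X" "tight X'" for X X'
  proof -
    obtain x x' where "X \<inter> T = {x}" "X' \<inter> T = {x'}"
      using tight unfolding tight_def is_singleton_def by blast
    then show ?thesis by (cases "x = x'") auto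
  qed
  \<comment> \<open>With disjoint traces, removing one set from the other does not change the trace
    of the latter.\<close>
  have diff: "?d X \<le> ?d (X - X')" "?d X' \<le> ?d (X' - X)"
    if "tight X" "tight X'" "X \<inter> X' \<inter> T = {}" for X X'
    using that by (auto intro!: tight_le)
  \<comment> \<open>If the traces were disjoint, \<open>e\<close> would make posimodularity strict,
    against \<open>diff\<close>.\<close>
  have joined: "X \<inter> T = X' \<inter> T"
    if "tight X" "tight X'" "a \<in> X \<inter> X'" "b \<notin> X \<union> X'" "B e = {a, b}" for X X' a b
    using tight_eq[OF that(1,2)] diff[OF that(1,2)]
      cut_size_posimodular_strict[OF mg e(1) that(5,3,4)] by fastforce
  \<comment> \<open>Intersection and union keep the common trace, so each has at least the cut size
    of \<open>X\<close>; submodularity then bounds each by that of \<open>X'\<close>.\<close>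
  have lattice: "?d (X \<inter> X') \<le> ?d X'" "?d (X \<union> X') \<le> ?d X'"
    if "tight X" "tight X'" "X \<inter> T = X' \<inter> T" for X X'
  proof -
    have "?d X \<le> ?d (X \<inter> X')" "?d X \<le> ?d (X \<union> X')"
      using that by (auto intro!: tight_le)
    then show "?d (X \<inter> X') \<le> ?d X'" "?d (X \<union> X') \<le> ?d X'"
      using cut_size_submodular[OF mg, of X X'] by linarith+
  qed
  \<comment> \<open>Obstructions sorted by the side of \<open>e\<close> that they contain: pairing
    \<open>e\<close> with an edge \<open>wy\<close> is blocked by a set of the first family
    containing \<open>w\<close> or one of the second missing \<open>w\<close>.\<close>
  define \<A> where "\<A> = {X. tight X \<and> u \<in> X \<and> y \<notin> X}"
  define \<B> where "\<B> = {X. tight X \<and> y \<in> X \<and> u \<notin> X}"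
  have union_A: "X \<union> X' \<in> \<A>" if "X \<in> \<A>" "X' \<in> \<A>" for X X'
  proof -
    have *: "tight X" "tight X'" "u \<in> X \<inter> X'" "y \<notin> X \<union> X'" using that by (auto simp: \<A>_def)
    have eq: "X \<inter> T = X' \<inter> T" using joined[OF * e(2)] .
    then have "(X \<union> X') \<inter> T = X' \<inter> T" by blast
    then show ?thesis using * lattice(2)[OF *(1,2) eq] by (auto simp: \<A>_def tight_def)
  qed
  have inter_B: "X \<inter> X' \<in> \<B>" if "X \<in> \<B>" "X' \<in> \<B>" for X X'
  proof -
    have *: "tight X" "tight X'" "y \<in> X \<inter> X'" "u \<notin> X \<union> X'" using that by (auto simp: \<B>_def)
    have eq: "X \<inter> T = X' \<inter> T" using joined[OF *] e(2) by (simp add: insert_commute)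
    then have "(X \<inter> X') \<inter> T = X' \<inter> T" by blast
    then show ?thesis using * lattice(1)[OF *(1,2) eq] by (auto simp: \<B>_def tight_def)
  qed
  \<comment> \<open>Equal traces are impossible, as \<open>e\<close> would make submodularity
    strict; so the traces are disjoint and posimodularity applies.\<close>
  have diff_B: "Z - X \<in> \<B>" if "X \<in> \<A>" "Z \<in> \<B>" for X Z
  proof -
    have *: "tight X" "tight Z" "u \<in> X - Z" "y \<in> Z - X" using that by (auto simp: \<A>_def \<B>_def)
    have "X \<inter> T \<noteq> Z \<inter> T"
    proof
      assume eq: "X \<inter> T = Z \<inter> T"
      have "?d X \<le> ?d (X \<inter> Z)" "?d Z \<le> ?d (X \<union> Z)"
        using * eq by (auto intro!: tight_le)
      then show False using cut_size_submodular_strict[OF mg e(1,2) *(3,4)] by linarith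
    qed
    then have dis: "X \<inter> Z \<inter> T = {}" using tight_eq[OF *(1,2)] by blast
    have "?d (Z - X) \<le> ?d Z"
      using diff[OF *(1,2) dis] cut_size_posimodular[OF mg, of X Z] by linarith
    moreover have "(Z - X) \<inter> T = Z \<inter> T" using dis by blast
    ultimately show ?thesis using * by (auto simp: \<B>_def tight_def)
  qed
  define W where "W = {w. w \<noteq> y \<and> (\<exists>f \<in> E. f \<noteq> e \<and> B f = {w, y})}"
  have bad: "(\<exists>X \<in> \<A>. w \<in> X) \<or> (\<exists>Z \<in> \<B>. w \<notin> Z)" if w: "w \<in> W" for w
  proof -
    obtain f where f: "f \<in> E" "f \<noteq> e" "B f = {w, y}" "w \<noteq> y" using w by (auto simp: W_def)
    obtain X where X: "odd (card (X \<inter> T))" "(u \<in> X) = (w \<in> X)" "(y \<in> X) \<noteq> (u \<in> X)"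
      "?d X < k + 2"
      using none[OF f] by (meson not_le)
    \<comment> \<open>A trace of size three becomes a singleton under complementation, because
      \<open>T\<close> has four elements.\<close>
    obtain X' where X': "card (X' \<inter> T) = 1" "(u \<in> X') = (w \<in> X')" "(y \<in> X') \<noteq> (u \<in> X')"
      "?d X' < k + 2"
    proof (cases "card (X \<inter> T) = 1")
      case True
      then show thesis using X that by blast
    next
      case False
      have finT: "finite T" using T by (auto intro: card_ge_0_finite)
      have "card (X \<inter> T) \<le> 4" using T card_mono[OF finT, of "X \<inter> T"] by simp
      then have "card (X \<inter> T) \<in> {0, 1, 2, 3, 4}" by auto
      with False X(1) have "card (X \<inter> T) = 3" by auto
      moreover have "- X \<inter> T = T - X \<inter> T" by auto
      ultimately have "card (- X \<inter> T) = 1"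
        using T finT by (simp add: card_Diff_subset)
      then show ?thesis
        using X by (intro that[of "- X"]) (auto simp: cut_size_Compl[OF mg])
    qed
    then show ?thesis
      by (cases "u \<in> X'") (auto simp: \<A>_def \<B>_def tight_def is_singleton_altdef)
  qed
  have "finite W"
  proof -
    have "W \<subseteq> (\<Union>f \<in> E. B f)" by (auto simp: W_def)
    moreover have "finite (\<Union>f \<in> E. B f)"
      using mg by (auto simp: multigraph_def intro: card_ge_0_finite)
    ultimately show ?thesis by (rule finite_subset)
  qed
  have deg_pos: "?d {y} \<noteq> 0" using e finE by (auto simp: cut_size_singleton)
  \<comment> \<open>Even and nonzero: \<open>y\<close> has an edge besides \<open>e\<close>, so
    there is a candidate partner.\<close>
  have deg: "2 \<le> ?d {y}"
    using inner[OF y] deg_pos by (intro dvd_imp_le) auto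
  have "W \<noteq> {}"
  proof
    assume "W = {}"
    have "{f \<in> E. y \<in> B f} = {e}"
    proof -
      have "f = e" if "f \<in> E" "y \<in> B f" for f
        using multigraph_edge_atE[OF mg that] \<open>W = {}\<close> that unfolding W_def by blast
      then show ?thesis using e(1,2) by blast
    qed
    then show False using deg by (simp add: cut_size_singleton)
  qed
  \<comment> \<open>The obstructions for single neighbours merge one at a time: by union, by
    intersection, or by difference when they are of different kinds.\<close>
  have "(\<exists>X \<in> \<A>. W \<subseteq> X) \<or> (\<exists>Z \<in> \<B>. W \<inter> Z = {})"
    using \<open>finite W\<close> \<open>W \<noteq> {}\<close> bad
  proof (induction W rule: finite_ne_induct)
    case (singleton w)
    then show ?case by auto
  next
    case (insert w F)
    have "(\<exists>X \<in> \<A>. F \<subseteq> X) \<or> (\<exists>Z \<in> \<B>. F \<inter> Z = {})" using insert by blast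
    moreover have "(\<exists>X \<in> \<A>. w \<in> X) \<or> (\<exists>Z \<in> \<B>. w \<notin> Z)" using insert by blast
    ultimately consider (AA) X X' where "X \<in> \<A>" "F \<subseteq> X" "X' \<in> \<A>" "w \<in> X'"
      | (AB) X Z where "X \<in> \<A>" "F \<subseteq> X" "Z \<in> \<B>" "w \<notin> Z"
      | (BA) X Z where "X \<in> \<A>" "w \<in> X" "Z \<in> \<B>" "F \<inter> Z = {}"
      | (BB) Z Z' where "Z \<in> \<B>" "F \<inter> Z = {}" "Z' \<in> \<B>" "w \<notin> Z'"
      by blast
    then show ?case
    proof cases
      case AA
      then have "X \<union> X' \<in> \<A>" "insert w F \<subseteq> X \<union> X'" using union_A by auto
      then show ?thesis by blast
    next
      case AB
      then have "Z - X \<in> \<B>" "insert w F \<inter> (Z - X) = {}" using diff_B by auto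
      then show ?thesis by blast
    next
      case BA
      then have "Z - X \<in> \<B>" "insert w F \<inter> (Z - X) = {}" using diff_B by auto
      then show ?thesis by blast
    next
      case BB
      then have "Z \<inter> Z' \<in> \<B>" "insert w F \<inter> (Z \<inter> Z') = {}" using inter_B by auto
      then show ?thesis by blast
    qed
  qed
  moreover have nbr: "B f \<subseteq> insert y (insert u W)" if f: "f \<in> E" "y \<in> B f" for f
  proof (cases "f = e")
    case False
    obtain w where "B f = {w, y}" "w \<noteq> y" using multigraph_edge_atE[OF mg f] .
    with f False show ?thesis by (auto simp: W_def)
  qed (use e(2) in auto)
  \<comment> \<open>Moving \<open>y\<close> into \<open>X\<close> keeps the trace, as
    \<open>y\<close> is not in \<open>T\<close>, but lowers the cut by the degree of
    \<open>y\<close>: a contradiction to tightness.\<close>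
  moreover have False if "X \<in> \<A>" "W \<subseteq> X" for X
  proof -
    have X: "y \<notin> X" "u \<in> X" "tight X" using that by (auto simp: \<A>_def)
    have "?d (insert y X) + ?d {y} = ?d X"
      using nbr that X by (intro cut_size_insert_vertex[OF mg]) blast+
    moreover have "?d X \<le> ?d (insert y X)" using X y by (intro tight_le) auto
    ultimately show False using deg by linarith
  qed
  \<comment> \<open>The mirror image: the complement of \<open>Z\<close> contains all neighbours of
    \<open>y\<close>, so \<open>y\<close> is moved out of \<open>Z\<close>.\<close>
  moreover have False if "Z \<in> \<B>" "W \<inter> Z = {}" for Z
  proof -
    have Z: "y \<in> Z" "u \<notin> Z" "tight Z" using that by (auto simp: \<B>_def)
    have "?d (insert y (- Z)) + ?d {y} = ?d (- Z)"
      using nbr that Z by (intro cut_size_insert_vertex[OF mg]) blast+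
    moreover have "?d (insert y (- Z)) = ?d (Z - {y})"
      using cut_size_Compl[OF mg, of "Z - {y}"] by (simp add: Compl_Diff_eq Un_commute)
    moreover have "?d Z \<le> ?d (Z - {y})" using Z y by (intro tight_le) auto
    ultimately show False using deg cut_size_Compl[OF mg, of Z] by linarith
  qed
  ultimately show False by blast
qed

section \<open>Packing joins when all edges lie within \<open>T\<close>\<close>

lemma join_packing_Suc:
  assumes "join_packing B (E - J) T k P" "J \<subseteq> E" "is_join B T J"
  shows "join_packing B E T (Suc k) (P(Suc k := J))"
proof -
  have P: "P i \<subseteq> E - J" "is_join B T (P i)" if "i \<in> {1..k}" for i
    using assms(1) that by (auto simp: join_packing_def)
  have disj: "P i \<inter> P j = {}" if "i \<in> {1..k}" "j \<in> {1..k}" "i \<noteq> j" for i j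
    using assms(1) that by (auto simp: join_packing_def disjoint_family_on_def)
  have range: "i \<in> {1..k} \<or> i = Suc k" if "i \<in> {1..Suc k}" for i
    using that by auto
  show ?thesis
    unfolding join_packing_def disjoint_family_on_def
  proof (intro conjI ballI impI)
    fix i j assume "i \<in> {1..Suc k}" "j \<in> {1..Suc k}" "i \<noteq> j"
    then show "(P(Suc k := J)) i \<inter> (P(Suc k := J)) j = {}"
      using range[of i] range[of j] P(1)[of i] P(1)[of j] disj[of i j] by auto
  next
    fix i assume "i \<in> {1..Suc k}"
    then show "(P(Suc k := J)) i \<subseteq> E" "is_join B T ((P(Suc k := J)) i)"
      using range[of i] P[of i] assms(2,3) by auto
  qed
qed

text \<open>Degree bounds suffice for the induction on \<open>k\<close>: the join removed uses one
  edge at each vertex of \<open>T\<close>, except for three at the centre of a star, whose degree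
  leaves room for that.\<close>

lemma join_packing_four_vertices:
  assumes "multigraph B E" "card T = 4" "\<And>e. e \<in> E \<Longrightarrow> B e \<subseteq> T"
    and "\<And>v. v \<in> T \<Longrightarrow> k \<le> cut_size B E {v}"
  shows "\<exists>P. join_packing B E T k P"
  using assms
proof (induction k arbitrary: E)
  case 0
  then show ?case by (auto simp: join_packing_def disjoint_family_on_def)
next
  case (Suc k)
  note mg = Suc.prems(1)
  have finE: "finite E" using mg by (simp add: multigraph_def)
  have finT: "finite T" using Suc.prems(2) by (auto intro: card_ge_0_finite)
  have step: ?case if J: "J \<subseteq> E" "is_join B T J"
    and degs: "\<And>v. v \<in> T \<Longrightarrow> k + cut_size B J {v} \<le> cut_size B E {v}" for J
  proof -
    have "\<exists>P. join_packing B (E - J) T k P"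
    proof (rule Suc.IH)
      show "multigraph B (E - J)" using mg by (rule multigraph_subset) auto
      show "card T = 4" by fact
      show "B e \<subseteq> T" if "e \<in> E - J" for e using Suc.prems(3) that by auto
      show "k \<le> cut_size B (E - J) {v}" if "v \<in> T" for v
        using degs[OF that] cut_size_Diff[OF finE J(1), of B "{v}"] by simp
    qed
    then show ?thesis using join_packing_Suc J by blast
  qed
  have edge_at: "\<exists>e \<in> E. v \<in> B e" if "v \<in> T" for v
  proof -
    have "card {e \<in> E. v \<in> B e} \<noteq> 0"
      using Suc.prems(4)[OF that] unfolding cut_size_singleton by linarith
    then have "{e \<in> E. v \<in> B e} \<noteq> {}" by (simp only: card_eq_0_iff) blast
    then show ?thesis by blast
  qed
  show ?case
  proof (cases "\<exists>e \<in> E. \<exists>f \<in> E. B e \<inter> B f = {}")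
    case True
    then obtain e f where ef: "e \<in> E" "f \<in> E" "B e \<inter> B f = {}" by blast
    have ne: "e \<noteq> f" using ef mg by (auto simp: multigraph_def)
    have "card (B e \<union> B f) = 4"
      using ef mg by (subst card_Un_disjoint) (auto simp: multigraph_def intro: card_ge_0_finite)
    then have T: "B e \<union> B f = T"
      using Suc.prems(2,3) ef finT by (metis Un_least card_subset_eq)
    have size: "cut_size B {e, f} {v} = of_bool (v \<in> T)" for v
      using ne ef(3) by (auto simp: cut_size_insert T[symmetric])
    show ?thesis
    proof (rule step)
      show "{e, f} \<subseteq> E" using ef by auto
      show "is_join B T {e, f}" by (auto simp: is_join_def size)
      show "k + cut_size B {e, f} {v} \<le> cut_size B E {v}" if "v \<in> T" for v
        using Suc.prems(4)[OF that] that by (simp add: size)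
    qed
  next
    \<comment> \<open>Pairwise meeting edges form a star or lie in a triangle, and a triangle would
      leave the fourth vertex of \<open>T\<close> without an edge. The edges \<open>e\<close>,
      \<open>f\<close>, \<open>g\<close> become the rays of the star.\<close>
    case False
    then have meet: "B e \<inter> B f \<noteq> {}" if "e \<in> E" "f \<in> E" for e f using that by blast
    have "T \<noteq> {}" using Suc.prems(2) by auto
    then obtain e where e: "e \<in> E" using edge_at by blast
    obtain a0 b0 where e0: "B e = {a0, b0}" "a0 \<noteq> b0" using multigraph_edgeE[OF mg e] .
    have "{a0, b0} \<subseteq> T" using Suc.prems(3)[OF e] e0 by auto
    then have "card (T - {a0, b0}) = 2" using e0 Suc.prems(2) by (simp add: card_Diff_subset)
    then obtain c d where cd: "T - {a0, b0} = {c, d}" "c \<noteq> d" by (auto simp: card_2_iff)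
    have T0: "T = {a0, b0, c, d}" "c \<notin> {a0, b0}" "d \<notin> {a0, b0}"
      using cd \<open>{a0, b0} \<subseteq> T\<close> by auto
    obtain f where f: "f \<in> E" "c \<in> B f" using edge_at T0 by blast
    obtain a where fa: "B f = {a, c}" "a \<noteq> c" using multigraph_edge_atE[OF mg f] .
    have "a \<in> {a0, b0}" using meet[OF e f(1)] fa e0 T0 by auto
    then obtain b where eb: "B e = {a, b}" "a \<noteq> b" and T: "T = {a, b, c, d}"
      and dist: "c \<notin> {a, b}" "d \<notin> {a, b}"
      using e0 T0 by (auto simp: insert_commute)
    obtain g where g: "g \<in> E" "d \<in> B g" using edge_at T by blast
    obtain a' where ga: "B g = {a', d}" "a' \<noteq> d" using multigraph_edge_atE[OF mg g] .
    \<comment> \<open>\<open>g\<close> meets both \<open>e\<close> and \<open>f\<close> in a vertex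
      other than \<open>d\<close>, and these share only \<open>a\<close>.\<close>
    have a': "a' = a" using meet[OF e g(1)] meet[OF f(1) g(1)] ga fa eb dist cd(2) by auto
    have star: "(\<exists>v \<in> {b, c, d}. B h = {a, v})" if h: "h \<in> E" for h
    proof -
      have "a \<in> B h"
      proof (rule ccontr)
        assume "a \<notin> B h"
        then have "{b, c, d} \<subseteq> B h"
          using meet[OF e h] meet[OF f(1) h] meet[OF g(1) h] fa eb ga a' by auto
        moreover have "card (B h) = 2" using mg h by (simp add: multigraph_def)
        ultimately have "card {b, c, d} \<le> 2" by (metis card_mono card.infinite zero_neq_numeral)
        then show False using dist cd(2) by auto
      qed
      then obtain v where "B h = {v, a}" "v \<noteq> a" using multigraph_edge_atE[OF mg h] by blast
      then show ?thesis using Suc.prems(3)[OF h] T by (auto simp: insert_commute)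
    qed
    \<comment> \<open>Every edge joins \<open>a\<close> to exactly one of \<open>b\<close>,
      \<open>c\<close>, \<open>d\<close>, so the degree of \<open>a\<close> is the sum of three
      degrees.\<close>
    have "cut_size B E {a} = cut_size B E {b} + cut_size B E {c} + cut_size B E {d}"
    proof -
      have "of_bool (a \<in> B h) = (of_bool (b \<in> B h) + of_bool (c \<in> B h) + of_bool (d \<in> B h) :: nat)"
        if h: "h \<in> E" for h
      proof -
        consider "B h = {a, b}" | "B h = {a, c}" | "B h = {a, d}" using star[OF h] by blast
        then show ?thesis by cases (use dist cd(2) eb(2) in auto)
      qed
      then show ?thesis
        using finE
        by (simp only: cut_size_eq_sum sum.distrib[symmetric] odd_card_Int_singleton cong: sum.cong)
    qed
    then have a_large: "3 * Suc k \<le> cut_size B E {a}"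
      using Suc.prems(4)[of b] Suc.prems(4)[of c] Suc.prems(4)[of d] T by simp
    have "e \<noteq> f" "e \<noteq> g" "f \<noteq> g" using eb fa ga a' dist cd(2) by (auto simp: doubleton_eq_iff)
    then have size: "cut_size B {e, f, g} {v} = (if v = a then 3 else of_bool (v \<in> T))" for v
      using eb fa ga a' dist cd(2) by (auto simp: cut_size_insert T)
    show ?thesis
    proof (rule step)
      show "{e, f, g} \<subseteq> E" using e f g by auto
      show "is_join B T {e, f, g}" by (auto simp: is_join_def size T)
      show "k + cut_size B {e, f, g} {v} \<le> cut_size B E {v}" if "v \<in> T" for v
        using Suc.prems(4)[OF that] a_large that by (auto simp: size)
    qed
  qed
qed

section \<open>Lifting packings and the induction on edges\<close>

lemma join_packing_mono: "join_packing B E' T k P \<Longrightarrow> E' \<subseteq> E \<Longrightarrow> join_packing B E T k P"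
  by (auto simp: join_packing_def)

text \<open>The edge that replaces the pair \<open>e\<close>, \<open>f\<close> keeps the name \<open>e\<close>.\<close>

lemma join_packing_lift:
  assumes "finite E" "e \<in> E" "f \<in> E" "f \<noteq> e" "B e = {u, y}" "B f = {w, y}" "u \<noteq> y" "w \<noteq> y" "u \<noteq> w"
    and P: "join_packing (B(e := {u, w})) (E - {f}) T k P"
  shows "join_packing B E T k (\<lambda>i. if e \<in> P i then insert f (P i) else P i)"
proof -
  let ?B = "B(e := {u, w})"
  have "is_join B T (if e \<in> P i then insert f (P i) else P i)" if i: "i \<in> {1..k}" for i
  proof -
    have Pi: "P i \<subseteq> E - {f}" and join: "is_join ?B T (P i)"
      using P i unfolding join_packing_def by blast+
    have fin: "finite (P i)" using Pi assms(1) by (meson finite_Diff finite_subset)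
    have out: "cut_size ?B (P i - {e}) X = cut_size B (P i - {e}) X" for X
      by (rule cut_size_cong) auto
    show ?thesis
    proof (cases "e \<in> P i")
      case True
      \<comment> \<open>Trading \<open>uw\<close> for \<open>uy\<close> and \<open>wy\<close>
        changes a degree only at \<open>y\<close>, where it grows by two.\<close>
      have "odd (cut_size B (insert f (P i)) {v}) = odd (cut_size ?B (P i) {v})" for v
      proof -
        have "f \<notin> P i" using Pi by auto
        then have "cut_size B (insert f (P i)) {v} =
          of_bool (v \<in> {w, y}) + (of_bool (v \<in> {u, y}) + cut_size B (P i - {e}) {v})"
          using fin True assms(5,6)
          by (simp add: cut_size_insert cut_size_remove[of "P i" e])
        moreover have "cut_size ?B (P i) {v} = of_bool (v \<in> {u, w}) + cut_size B (P i - {e}) {v}"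
          using fin True by (simp add: cut_size_remove[of "P i" e] out)
        ultimately show ?thesis using assms(7-9) by auto
      qed
      then show ?thesis using join True by (simp add: is_join_def)
    next
      case False
      then have "cut_size ?B (P i) {v} = cut_size B (P i) {v}" for v
        by (intro cut_size_cong) auto
      then show ?thesis using join False by (simp add: is_join_def)
    qed
  qed
  moreover have sub: "P i \<subseteq> E - {f}" if "i \<in> {1..k}" for i
    using P that by (auto simp: join_packing_def)
  then have "(if e \<in> P i then insert f (P i) else P i) \<subseteq> E" if "i \<in> {1..k}" for i
    using assms(3) that by auto
  \<comment> \<open>\<open>f\<close> is in none of the \<open>P i\<close> and is added to at most
    one of them, the one containing \<open>e\<close>.\<close>
  moreover have "(if e \<in> P i then insert f (P i) else P i) \<inter> (if e \<in> P j then insert f (P j) else P j) = {}"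
    if "i \<in> {1..k}" "j \<in> {1..k}" "i \<noteq> j" for i j
  proof -
    have "P i \<inter> P j = {}" using P that by (auto simp: join_packing_def disjoint_family_on_def)
    then show ?thesis using sub[of i] sub[of j] that by auto
  qed
  ultimately show ?thesis
    by (simp only: join_packing_def disjoint_family_on_def) blast
qed

text \<open>Induction on the number of edges: each split lowers it, even if \<open>y\<close> keeps
  other edges. \<open>B\<close> has to vary, since splitting redirects \<open>e\<close>.\<close>

lemma exists_join_packing:
  assumes "multigraph B E" "card T = 4"
    and "\<And>v. v \<notin> T \<Longrightarrow> even (cut_size B E {v})"
    and "\<And>X. odd (card (X \<inter> T)) \<Longrightarrow> k \<le> cut_size B E X"
  shows "\<exists>P. join_packing B E T k P"
  using assms
proof (induction "card E" arbitrary: E B rule: less_induct)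
  case less
  note mg = less.prems(1)
  have finE: "finite E" using mg by (simp add: multigraph_def)
  show ?case
  proof (cases "\<forall>e \<in> E. B e \<subseteq> T")
    case True
    show ?thesis
      using True less.prems(4) by (intro join_packing_four_vertices[OF mg less.prems(2)]) auto
  next
    case False
    then obtain e y where e: "e \<in> E" "y \<in> B e" and y: "y \<notin> T" by blast
    obtain u where u: "B e = {u, y}" "u \<noteq> y" using multigraph_edge_atE[OF mg e] .
    obtain f w where f: "f \<in> E" "f \<noteq> e" "B f = {w, y}" "w \<noteq> y"
      and split: "\<And>X. odd (card (X \<inter> T)) \<Longrightarrow> (u \<in> X) = (w \<in> X) \<Longrightarrow> (y \<in> X) \<noteq> (u \<in> X) \<Longrightarrow>
         k + 2 \<le> cut_size B E X"
      using exists_splittable_edge[OF mg less.prems(3,4,2) y e(1) u] by blast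
    let ?E = "E - {e, f}"
    have size: "cut_size B E X =
      of_bool ((u \<in> X) \<noteq> (y \<in> X)) + of_bool ((w \<in> X) \<noteq> (y \<in> X)) + cut_size B ?E X" for X
      using finE e f u cut_size_remove[of "E - {e}" f B X]
      by (simp add: cut_size_remove[of E e B X] Diff_insert2[symmetric] Diff_insert[symmetric] insert_commute)
    have smaller: "card ?E < card E" "card (E - {f}) < card E"
      using finE e f by (intro psubset_card_mono; blast)+
    show ?thesis
    proof (cases "u = w")
      case True
      have "\<exists>P. join_packing B ?E T k P"
      proof (rule less.hyps)
        show "multigraph B ?E" using mg by (rule multigraph_subset) auto
        show "even (cut_size B ?E {v})" if "v \<notin> T" for v
          using less.prems(3)[OF that] size[of "{v}"] True by auto
        show "k \<le> cut_size B ?E X" if "odd (card (X \<inter> T))" for X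
          using less.prems(4)[OF that] split[OF that] size[of X] True
          by (cases "u \<in> X"; cases "y \<in> X") auto
      qed (use smaller less.prems(2) in auto)
      then show ?thesis using join_packing_mono by blast
    next
      case False
      let ?B = "B(e := {u, w})"
      have size': "cut_size ?B (E - {f}) X = of_bool ((u \<in> X) \<noteq> (w \<in> X)) + cut_size B ?E X" for X
      proof -
        have "cut_size ?B ?E X = cut_size B ?E X" by (rule cut_size_cong) auto
        then show ?thesis
          using finE e f False cut_size_remove[of "E - {f}" e ?B X]
          by (simp add: Diff_insert[symmetric] insert_commute)
      qed
      have "\<exists>P. join_packing ?B (E - {f}) T k P"
      proof (rule less.hyps)
        show "multigraph ?B (E - {f})" using mg False by (auto simp: multigraph_def)
        show "even (cut_size ?B (E - {f}) {v})" if "v \<notin> T" for v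
          using less.prems(3)[OF that] size[of "{v}"] size'[of "{v}"] f(4) u(2) False by auto
        \<comment> \<open>If \<open>u\<close> and \<open>w\<close> are on different sides, the new
          edge makes up for the one lost. If they are on the same side, the cut changes only when
          \<open>y\<close> is opposite, and then \<open>split\<close> pays for the two lost
          edges.\<close>
        show "k \<le> cut_size ?B (E - {f}) X" if "odd (card (X \<inter> T))" for X
          using less.prems(4)[OF that] split[OF that] size[of X] size'[of X]
          by (cases "u \<in> X"; cases "y \<in> X"; cases "w \<in> X") auto
      qed (use smaller less.prems(2) in auto)
      then show ?thesis
        using join_packing_lift[OF finE e(1) f(1,2) u(1) f(3) u(2) f(4) False] by blast
    qed
  qed
qed

section \<open>Translation between chains and joins\<close>

text \<open>The coefficient of a vertex in the boundary is its degree modulo 2. Distinctness keeps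
  the four generators from cancelling.\<close>

lemma boundary_eq_iff_is_join:
  assumes "multigraph (bd G) (Poly_Mapping.keys p)" "distinct [v1, v2, v3, v4]"
  shows "boundary G p = gen v1 + gen v2 + gen v3 + gen v4 \<longleftrightarrow>
    is_join (bd G) {v1, v2, v3, v4} (Poly_Mapping.keys p)"
proof -
  have "Poly_Mapping.lookup (boundary G p) v = of_nat (cut_size (bd G) (Poly_Mapping.keys p) {v})" for v
  proof -
    have "(\<Sum>a \<in> bd G e. Poly_Mapping.lookup (gen a) v) = of_bool (v \<in> bd G e)"
      if "e \<in> Poly_Mapping.keys p" for e
    proof -
      have "finite (bd G e)"
        using assms(1) that by (auto simp: multigraph_def intro: card_ge_0_finite)
      then show ?thesis by (simp add: gen_def lookup_single when_def)
    qed
    then show ?thesis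
      by (simp add: boundary_def lookup_sum cut_size_eq_sum)
  qed
  moreover have "Poly_Mapping.lookup (gen v1 + gen v2 + gen v3 + gen v4) v = of_bool (v \<in> {v1, v2, v3, v4})" for v
    using assms(2) by (auto simp: gen_def lookup_add lookup_single when_def)
  moreover have "of_nat n = (of_bool b :: bit) \<longleftrightarrow> (odd n \<longleftrightarrow> b)" for n b
  proof -
    have "of_nat n = (of_bool (odd n) :: bit)" by (induction n) auto
    then show ?thesis by simp
  qed
  ultimately show ?thesis
    by (simp only: poly_mapping_eq_iff fun_eq_iff is_join_def)
qed

lemma exists_chain_with_keys:
  fixes P :: "'e set"
  assumes "finite P"
  obtains p :: "'e \<Rightarrow>\<^sub>0 bit" where "Poly_Mapping.keys p = P"
proof
  have "Poly_Mapping.lookup (Abs_poly_mapping (\<lambda>e. of_bool (e \<in> P) :: bit)) = (\<lambda>e. of_bool (e \<in> P))"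
    using assms by (intro lookup_Abs_poly_mapping) simp
  then show "Poly_Mapping.keys (Abs_poly_mapping (\<lambda>e. of_bool (e \<in> P) :: bit)) = P"
    by (auto simp: in_keys_iff)
qed

section \<open>Cut condition and parity in \<open>GN\<close>\<close>

theorem theorem2p8:
  fixes G GN :: "('v, 'e) graph"
    and k :: nat
    and v1 v2 v3 v4 :: 'v
    and Y Yodd :: "'v set"
    and N :: "'e set"
  assumes "k > 0"
    and "is_graph G"
    and "distinct [v1, v2, v3, v4]"
    and "verts G = {v1, v2, v3, v4} \<union> Y"
    and "{v1, v2, v3, v4} \<inter> Y = {}"
    and "Yodd = {y \<in> Y. odd (degree G y)}"
    and "\<And>D. D \<subseteq> edges G \<Longrightarrow> card D \<le> k - 1 \<Longrightarrow>
           \<exists>p \<in> chains_on (edges (delete_edges G D)).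
             boundary (delete_edges G D) p = gen v1 + gen v2 + gen v3 + gen v4"
    and "adds_edges G N GN"
    and "\<And>e. e \<in> N \<Longrightarrow>
           \<exists>a b. a \<in> Yodd \<and> b \<in> {v1, v2, v3, v4} \<union> Yodd \<and> a \<noteq> b \<and> bd GN e = {a, b}"
    and "\<And>y. y \<in> Yodd \<Longrightarrow> \<exists>!e. e \<in> N \<and> y \<in> bd GN e"
  shows "\<exists>p :: nat \<Rightarrow> 'e \<Rightarrow>\<^sub>0 bit.
           (\<forall>i \<in> {1..k}. p i \<in> chains_on (edges GN) \<and>
              boundary GN (p i) = gen v1 + gen v2 + gen v3 + gen v4) \<and>
           (\<forall>i \<in> {1..k}. \<forall>j \<in> {1..k}. i \<noteq> j \<longrightarrow> no_common_summand (p i) (p j))"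
proof -
  let ?T = "{v1, v2, v3, v4}" and ?E = "edges GN"
  note dist = assms(3)
  have N: "N \<inter> edges G = {}" "?E = edges G \<union> N" and bd: "\<And>e. e \<in> edges G \<Longrightarrow> bd GN e = bd G e"
    and GN: "is_graph GN" "verts GN = verts G"
    using assms(8) by (auto simp: adds_edges_def)
  have mgG: "multigraph (bd G) (edges G)" using assms(2) by (auto simp: is_graph_def multigraph_def)
  have mg: "multigraph (bd GN) ?E" using GN by (auto simp: is_graph_def multigraph_def)
  have finE: "finite ?E" using mg by (simp add: multigraph_def)
  have T: "card ?T = 4" using dist by simp
  have "\<exists>P. join_packing (bd GN) ?E ?T k P"
  proof (rule exists_join_packing[OF mg T])
    fix v assume v: "v \<notin> ?T"
    have "cut_size (bd GN) ?E {v} = cut_size (bd GN) (edges G) {v} + cut_size (bd GN) N {v}"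
      using cut_size_Diff[OF finE, of N "bd GN" "{v}"] N by (simp add: Un_Diff Diff_triv Int_commute)
    also have "cut_size (bd GN) (edges G) {v} = degree G v"
      unfolding degree_def cut_size_singleton[symmetric] by (rule cut_size_cong[OF bd])
    finally have size: "cut_size (bd GN) ?E {v} = degree G v + cut_size (bd GN) N {v}" .
    show "even (cut_size (bd GN) ?E {v})"
    proof (cases "v \<in> Yodd")
      case True
      \<comment> \<open>Exactly one new edge corrects the odd degree of \<open>v\<close>.\<close>
      then obtain e where "{e \<in> N. v \<in> bd GN e} = {e}" using assms(10)[OF True] by blast
      then show ?thesis using size True assms(6) by (simp add: cut_size_singleton)
    next
      case False
      have "{e \<in> N. v \<in> bd GN e} = {}" using assms(9) False v by fastforce
      moreover have "even (degree G v)"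
      proof (cases "v \<in> Y")
        case True
        then show ?thesis using False assms(6) by simp
      next
        \<comment> \<open>\<open>v\<close> ranges over the whole type; here it is not a vertex of
          \<open>G\<close> at all.\<close>
        case outside: False
        have "{e \<in> edges G. v \<in> bd G e} = {}"
          using assms(2,4) outside v by (auto simp: is_graph_def)
        then show ?thesis by (simp only: degree_def card.empty even_zero)
      qed
      ultimately show ?thesis using size by (simp only: cut_size_singleton card.empty even_add) simp
    qed
  next
    fix X assume X: "odd (card (X \<inter> ?T))"
    \<comment> \<open>The cut of \<open>X\<close> is itself the set to delete: with fewer than
      \<open>k\<close> edges, a chain would survive that avoids the cut, against parity.\<close>
    let ?D = "{e \<in> edges G. odd (card (bd G e \<inter> X))}"
    have "k \<le> card ?D"
    proof (rule ccontr)
      assume "\<not> k \<le> card ?D"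
      then have "card ?D \<le> k - 1" by linarith
      moreover have "?D \<subseteq> edges G" by blast
      ultimately obtain p where p: "p \<in> chains_on (edges (delete_edges G ?D))"
        "boundary (delete_edges G ?D) p = gen v1 + gen v2 + gen v3 + gen v4"
        using assms(7)[of ?D] by blast
      have keys: "Poly_Mapping.keys p \<subseteq> edges G - ?D"
        using p(1) by (simp add: chains_on_def delete_edges_def)
      then have mgp: "multigraph (bd G) (Poly_Mapping.keys p)"
        using multigraph_subset[OF mgG] by blast
      have "is_join (bd G) ?T (Poly_Mapping.keys p)"
        using boundary_eq_iff_is_join[of "delete_edges G ?D" p, OF _ dist] mgp p(2)
        by (simp add: delete_edges_def)
      then have "odd (cut_size (bd G) (Poly_Mapping.keys p) X)"
        using odd_cut_size_join[OF mgp] X by blast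
      moreover have "{e \<in> Poly_Mapping.keys p. odd (card (bd G e \<inter> X))} = {}" using keys by auto
      ultimately show False by (simp only: cut_size_def card.empty even_zero not_True_eq_False)
    qed
    also have "card ?D = cut_size (bd GN) (edges G) X"
      using cut_size_cong[of "edges G" "bd GN" "bd G", OF bd] by (simp add: cut_size_def)
    also have "\<dots> \<le> cut_size (bd GN) ?E X" using finE N(2) by (intro cut_size_mono) auto
    finally show "k \<le> cut_size (bd GN) ?E X" .
  qed
  then obtain P where sub: "\<And>i. i \<in> {1..k} \<Longrightarrow> P i \<subseteq> ?E"
    and join: "\<And>i. i \<in> {1..k} \<Longrightarrow> is_join (bd GN) ?T (P i)"
    and disj: "disjoint_family_on P {1..k}"
    unfolding join_packing_def by blast
  \<comment> \<open>Over the two-element field any finite edge set is the support of a chain, so the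
    joins turn back into chains.\<close>
  have "\<exists>p :: 'e \<Rightarrow>\<^sub>0 bit. Poly_Mapping.keys p = P i" if "i \<in> {1..k}" for i
    using exists_chain_with_keys[of "P i"] finite_subset[OF sub[OF that] finE] by metis
  then obtain p :: "nat \<Rightarrow> 'e \<Rightarrow>\<^sub>0 bit" where p: "\<And>i. i \<in> {1..k} \<Longrightarrow> Poly_Mapping.keys (p i) = P i"
    by metis
  have "boundary GN (p i) = gen v1 + gen v2 + gen v3 + gen v4" if i: "i \<in> {1..k}" for i
    using boundary_eq_iff_is_join[OF _ dist, of GN "p i"] multigraph_subset[OF mg sub[OF i]] join[OF i] p[OF i]
    by simp
  moreover have "p i \<in> chains_on ?E" if "i \<in> {1..k}" for i
    using p[OF that] sub[OF that] by (simp add: chains_on_def)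
  moreover have "no_common_summand (p i) (p j)" if "i \<in> {1..k}" "j \<in> {1..k}" "i \<noteq> j" for i j
    using disj that p by (simp add: no_common_summand_def disjoint_family_on_def)
  ultimately show ?thesis by blast
qed

end
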